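(* For any positive integer $n$, there exists an $n$-vertex directed graph $G=(V,E)$ with a source $s$, a sink $t$, and $(s,t)$-max-flow value one, such that any family $\mathcal{A}$ and any family $\mathcal{B}$ (as defined below) must contain at least $\Omega(n)$ flows.
   Context: Edges have unit capacity. $\mathcal{A}$ denotes a family of $(s,t)$-max-flows of $G$ such that for every set $F\subseteq E$ with $|F|=2$ and $\textsc{max-flow}(s,t,G)=\textsc{max-flow}(s,t,G-F)$, $\mathcal{A}$ contains an $(s,t)$-max-flow of $G-F$. $\mathcal{B}$ denotes a family of flows that contains an $(s,t)$-max-flow of $G-F$ for every set $F\subseteq E$ with $|F|=2$. Here $G-F$ is $G$ with the edges of $F$ deleted and $\textsc{max-flow}(s,t,\cdot)$ is the $(s,t)$-max-flow value.
   Formalization: The claim is proved for every n at least 2 rather than every positive n, since a one-vertex graph cannot have max-flow value one; the bound Ω(n) is read asymptotically as n grows. *)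

theory Defs
  imports
    "HOL-Analysis.Analysis"
    "HOL-Library.Landau_Symbols"
    "Graph_Theory.Graph_Theory"
begin

text \<open>
  A flow is a real-valued function on all pairs that vanishes off the arcs. Hence two flows of a
  graph are equal iff they agree on its arcs, and a flow of a graph with some arcs deleted is
  also a flow of the original graph.
\<close>

definition st_flow :: "'a pair_pre_digraph \<Rightarrow> 'a \<Rightarrow> 'a \<Rightarrow> ('a \<times> 'a \<Rightarrow> real) \<Rightarrow> bool" where
  "st_flow G s t f \<longleftrightarrow>
     (\<forall>e. e \<notin> parcs G \<longrightarrow> f e = 0) \<and>
     (\<forall>e\<in>parcs G. 0 \<le> f e \<and> f e \<le> 1) \<and>
     (\<forall>v\<in>pverts G - {s, t}. (\<Sum>e\<in>in_arcs G v. f e) = (\<Sum>e\<in>out_arcs G v. f e))"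

definition flow_value :: "'a pair_pre_digraph \<Rightarrow> 'a \<Rightarrow> ('a \<times> 'a \<Rightarrow> real) \<Rightarrow> real" where
  "flow_value G s f = (\<Sum>e\<in>out_arcs G s. f e) - (\<Sum>e\<in>in_arcs G s. f e)"

definition st_max_flow :: "'a pair_pre_digraph \<Rightarrow> 'a \<Rightarrow> 'a \<Rightarrow> ('a \<times> 'a \<Rightarrow> real) \<Rightarrow> bool" where
  "st_max_flow G s t f \<longleftrightarrow>
     st_flow G s t f \<and> (\<forall>g. st_flow G s t g \<longrightarrow> flow_value G s g \<le> flow_value G s f)"

text \<open>
  For a finite graph the set of flow values is nonempty (zero flow) and bounded above (by the
  out-degree of the source), so the real supremum is well-behaved.
\<close>

definition max_flow_value :: "'a pair_pre_digraph \<Rightarrow> 'a \<Rightarrow> 'a \<Rightarrow> real" where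
  "max_flow_value G s t = (SUP f\<in>{f. st_flow G s t f}. flow_value G s f)"

definition del_arcs :: "'a pair_pre_digraph \<Rightarrow> ('a \<times> 'a) set \<Rightarrow> 'a pair_pre_digraph" where
  "del_arcs G F = G\<lparr>parcs := parcs G - F\<rparr>"

definition family_A ::
  "'a pair_pre_digraph \<Rightarrow> 'a \<Rightarrow> 'a \<Rightarrow> ('a \<times> 'a \<Rightarrow> real) set \<Rightarrow> bool" where
  "family_A G s t \<A> \<longleftrightarrow>
     (\<forall>f\<in>\<A>. st_max_flow G s t f) \<and>
     (\<forall>F. F \<subseteq> parcs G \<and> card F = 2 \<and> max_flow_value G s t = max_flow_value (del_arcs G F) s t
        \<longrightarrow> (\<exists>f\<in>\<A>. st_max_flow (del_arcs G F) s t f))"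

definition family_B ::
  "'a pair_pre_digraph \<Rightarrow> 'a \<Rightarrow> 'a \<Rightarrow> ('a \<times> 'a \<Rightarrow> real) set \<Rightarrow> bool" where
  "family_B G s t \<B> \<longleftrightarrow>
     (\<forall>f\<in>\<B>. st_flow G s t f) \<and>
     (\<forall>F. F \<subseteq> parcs G \<and> card F = 2 \<longrightarrow> (\<exists>f\<in>\<B>. st_max_flow (del_arcs G F) s t f))"

end

theory Submission
  imports Defs
begin

text \<open>
  Take a ladder with rails \<open>0 \<rightarrow> 2 \<rightarrow> 4 \<rightarrow> \<dots>\<close> and
  \<open>1 \<rightarrow> 3 \<rightarrow> 5 \<rightarrow> \<dots>\<close>, joined by rungs \<open>2i \<rightarrow> 2i + 1\<close>, with
  source \<open>0\<close> and the last odd vertex as sink. Deleting the even rail just after rung \<open>i\<close> and the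
  odd rail just before it forces the unit of flow through rung \<open>i\<close>. Deleting such pairs for two
  different rungs separates the source from the sink, so different rungs need different flows.
\<close>

section \<open>Deleting arcs\<close>

lemma st_flowD:
  assumes "st_flow G s t f"
  shows "e \<notin> parcs G \<Longrightarrow> f e = 0" "0 \<le> f e" "f e \<le> 1"
proof -
  have "f e = 0 \<or> 0 \<le> f e \<and> f e \<le> 1"
    using assms unfolding st_flow_def by blast
  then show "0 \<le> f e" "f e \<le> 1" by auto
  show "e \<notin> parcs G \<Longrightarrow> f e = 0"
    using assms unfolding st_flow_def by blast
qed

lemma in_arcs_del_arcs: "in_arcs (del_arcs G F) v = in_arcs G v - F"
  by (auto simp: del_arcs_def in_arcs_def)

lemma out_arcs_del_arcs: "out_arcs (del_arcs G F) v = out_arcs G v - F"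
  by (auto simp: del_arcs_def out_arcs_def)

lemma pair_sums_del_arcs:
  fixes f :: "'a \<times> 'a \<Rightarrow> real"
  assumes "finite (parcs G)" "\<forall>e\<in>F. f e = 0"
  shows "sum f (in_arcs (del_arcs G F) v) = sum f (in_arcs G v)"
    and "sum f (out_arcs (del_arcs G F) v) = sum f (out_arcs G v)"
proof -
  have "finite (in_arcs G v)" "finite (out_arcs G v)"
    using assms(1) by (auto simp: in_arcs_def out_arcs_def)
  then show "sum f (in_arcs (del_arcs G F) v) = sum f (in_arcs G v)"
    and "sum f (out_arcs (del_arcs G F) v) = sum f (out_arcs G v)"
    unfolding in_arcs_del_arcs out_arcs_del_arcs
    using assms(2) by (auto intro!: sum.mono_neutral_left)
qed

lemma flow_value_del_arcs:
  assumes "finite (parcs G)" "\<forall>e\<in>F. f e = 0"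
  shows "flow_value (del_arcs G F) s f = flow_value G s f"
  by (simp add: flow_value_def pair_sums_del_arcs[OF assms])

text \<open>Removing arcs on which \<open>f\<close> is zero changes no in- or out-sum. Deletions
  thus become vanishing conditions, and flows for different \<open>F\<close> are compared inside the
  single graph \<open>G\<close>.\<close>

lemma st_flow_del_arcs_iff:
  assumes "finite (parcs G)"
  shows "st_flow (del_arcs G F) s t f \<longleftrightarrow> st_flow G s t f \<and> (\<forall>e\<in>F. f e = 0)"
proof (cases "\<forall>e\<in>F. f e = 0")
  case True
  note sums = pair_sums_del_arcs[OF assms True]
  have "pverts (del_arcs G F) = pverts G" "parcs (del_arcs G F) = parcs G - F"
    by (simp_all add: del_arcs_def)
  then show ?thesis
    using True by (auto simp: st_flow_def sums)
next
  case False
  then show ?thesis by (auto simp: st_flow_def del_arcs_def)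
qed

section \<open>A criterion for large families\<close>

lemma max_flow_value_eqI:
  assumes "\<And>g. st_flow G s t g \<Longrightarrow> flow_value G s g \<le> c"
    and "st_flow G s t f" "flow_value G s f = c"
  shows "max_flow_value G s t = c"
  unfolding max_flow_value_def
  by (rule cSup_eq_maximum) (use assms in auto)

lemma card_le_of_separated:
  assumes "\<And>i. i \<in> I \<Longrightarrow> \<exists>a\<in>A. R i a"
    and "\<And>i j a. \<lbrakk>i \<in> I; j \<in> I; i \<noteq> j; R i a\<rbrakk> \<Longrightarrow> \<not> R j a"
    and "finite A"
  shows "card I \<le> card A"
proof -
  obtain h where h: "\<And>i. i \<in> I \<Longrightarrow> h i \<in> A \<and> R i (h i)"
    using assms(1) by metis
  have "inj_on h I"
    by (rule inj_onI) (metis h assms(2))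
  then show ?thesis
    using h assms(3) by (auto intro: card_inj_on_le)
qed

text \<open>Each deletion \<open>F i\<close> leaves the maximum at 1, so both families must hold a
  flow of value 1 vanishing on \<open>F i\<close>. By \<open>sep\<close> no flow serves two indices,
  so choosing one flow per index is injective.\<close>

lemma families_large:
  assumes fin: "finite (parcs G)"
    and le: "\<And>g. st_flow G s t g \<Longrightarrow> flow_value G s g \<le> 1"
    and F: "\<And>i. i \<in> I \<Longrightarrow> F i \<subseteq> parcs G \<and> card (F i) = 2"
    and ex: "\<And>i. i \<in> I \<Longrightarrow>
      \<exists>f. st_flow G s t f \<and> flow_value G s f = 1 \<and> (\<forall>e\<in>F i. f e = 0)"
    and sep: "\<And>i j f. \<lbrakk>i \<in> I; j \<in> I; i \<noteq> j; st_flow G s t f; \<forall>e\<in>F i \<union> F j. f e = 0\<rbrakk>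
      \<Longrightarrow> flow_value G s f \<noteq> 1"
  shows "family_A G s t \<A> \<Longrightarrow> infinite \<A> \<or> card I \<le> card \<A>"
    and "family_B G s t \<B> \<Longrightarrow> infinite \<B> \<or> card I \<le> card \<B>"
proof -
  define R where "R i f \<longleftrightarrow> st_max_flow (del_arcs G (F i)) s t f" for i f
  have le_del: "flow_value (del_arcs G (F i)) s g \<le> 1"
    if "st_flow (del_arcs G (F i)) s t g" for i g
    using that le flow_value_del_arcs[OF fin] st_flow_del_arcs_iff[OF fin] by metis
  have ex_del: "\<exists>f. st_flow (del_arcs G (F i)) s t f \<and> flow_value (del_arcs G (F i)) s f = 1"
    if "i \<in> I" for i
    using ex[OF that] flow_value_del_arcs[OF fin] st_flow_del_arcs_iff[OF fin] by metis
  have R: "st_flow G s t f \<and> flow_value G s f = 1 \<and> (\<forall>e\<in>F i. f e = 0)"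
    if "i \<in> I" "R i f" for i f
  proof -
    have f: "st_flow (del_arcs G (F i)) s t f"
      using that(2) by (simp add: R_def st_max_flow_def)
    have "flow_value (del_arcs G (F i)) s f = 1"
      using ex_del[OF that(1)] le_del[OF f] that(2)
      by (metis R_def st_max_flow_def antisym)
    then show ?thesis
      using f flow_value_del_arcs[OF fin] st_flow_del_arcs_iff[OF fin] by metis
  qed
  have separated: "\<not> R j f" if "i \<in> I" "j \<in> I" "i \<noteq> j" "R i f" for i j f
    using R[of i f] R[of j f] sep[of i j f] that by auto
  \<comment> \<open>A family of the first kind only answers to deletions that keep the max-flow
    value.\<close>
  have preserved: "max_flow_value G s t = max_flow_value (del_arcs G (F i)) s t" if i: "i \<in> I" for i
  proof -
    have "max_flow_value G s t = 1"
      using ex[OF i] max_flow_value_eqI le by metis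
    moreover have "max_flow_value (del_arcs G (F i)) s t = 1"
      using ex_del[OF i] max_flow_value_eqI le_del by metis
    ultimately show ?thesis by simp
  qed
  show "infinite \<A> \<or> card I \<le> card \<A>" if "family_A G s t \<A>"
  proof (cases "finite \<A>")
    case True
    have "\<exists>f\<in>\<A>. R i f" if "i \<in> I" for i
      using \<open>family_A G s t \<A>\<close> F[OF that] preserved[OF that] by (auto simp: family_A_def R_def)
    then have "card I \<le> card \<A>"
      by (rule card_le_of_separated[of I \<A> R]) (use separated True in auto)
    then show ?thesis ..
  qed simp
  show "infinite \<B> \<or> card I \<le> card \<B>" if "family_B G s t \<B>"
  proof (cases "finite \<B>")
    case True
    have "\<exists>f\<in>\<B>. R i f" if "i \<in> I" for i
      using \<open>family_B G s t \<B>\<close> F[OF that] by (auto simp: family_B_def R_def)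
    then have "card I \<le> card \<B>"
      by (rule card_le_of_separated[of I \<B> R]) (use separated True in auto)
    then show ?thesis ..
  qed simp
qed

section \<open>The ladder\<close>

text \<open>
  The rung at \<open>0\<close> is omitted so that the source has a single outgoing arc; it is kept only in
  the degenerate ladder with \<open>k = 1\<close>, where it is the whole graph.
\<close>

definition ladder_arcs :: "nat \<Rightarrow> (nat \<times> nat) set" where
  "ladder_arcs k =
    {(x, y). y < 2 * k \<and> (y = x + 2 \<or> (y = x + 1 \<and> even x \<and> (0 < x \<or> k = 1)))}"

definition ladder :: "nat \<Rightarrow> nat \<Rightarrow> nat pair_pre_digraph" where
  "ladder n k = \<lparr>pverts = {..<n}, parcs = ladder_arcs k\<rparr>"

lemma ladder_sel [simp]: "pverts (ladder n k) = {..<n}" "parcs (ladder n k) = ladder_arcs k"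
  by (simp_all add: ladder_def)

lemma finite_ladder_arcs: "finite (ladder_arcs k)"
  by (rule finite_subset[of _ "{..<2 * k} \<times> {..<2 * k}"]) (auto simp: ladder_arcs_def)

lemma pair_digraph_ladder:
  assumes "2 * k \<le> n"
  shows "pair_digraph (ladder n k)"
  using assms by unfold_locales (auto simp: finite_ladder_arcs, auto simp: ladder_arcs_def)

text \<open>As \<open>f\<close> vanishes off the arcs, each sum may range over all candidate
  neighbours at distance 1 and 2, whether or not these arcs exist. This avoids case splits on parity
  and on the ends of the ladder.\<close>

lemma ladder_sums:
  fixes f :: "nat \<times> nat \<Rightarrow> real"
  assumes "\<forall>e. e \<notin> ladder_arcs k \<longrightarrow> f e = 0"
  shows "sum f (out_arcs (ladder n k) x) = f (x, x + 1) + f (x, x + 2)"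
    and "sum f (in_arcs (ladder n k) 0) = 0"
    and "sum f (in_arcs (ladder n k) 1) = f (0, 1)"
    and "sum f (in_arcs (ladder n k) (x + 2)) = f (x, x + 2) + f (x + 1, x + 2)"
proof -
  have "sum f (out_arcs (ladder n k) x) = sum f {(x, x + 1), (x, x + 2)}"
    by (rule sum.mono_neutral_left) (auto simp: ladder_arcs_def intro!: assms[rule_format])
  then show "sum f (out_arcs (ladder n k) x) = f (x, x + 1) + f (x, x + 2)" by simp
  have "in_arcs (ladder n k) 0 = {}" by (auto simp: ladder_arcs_def)
  then show "sum f (in_arcs (ladder n k) 0) = 0" by simp
  have "sum f (in_arcs (ladder n k) 1) = sum f {(0, 1)}"
    by (rule sum.mono_neutral_left) (auto simp: ladder_arcs_def intro!: assms[rule_format])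
  then show "sum f (in_arcs (ladder n k) 1) = f (0, 1)" by simp
  have "sum f (in_arcs (ladder n k) (x + 2)) = sum f {(x, x + 2), (x + 1, x + 2)}"
    by (rule sum.mono_neutral_left) (auto simp: ladder_arcs_def intro!: assms[rule_format])
  then show "sum f (in_arcs (ladder n k) (x + 2)) = f (x, x + 2) + f (x + 1, x + 2)" by simp
qed

lemma ladder_flow_value:
  assumes "st_flow (ladder n k) 0 t f"
  shows "flow_value (ladder n k) 0 f = f (0, 1) + f (0, 2)"
proof -
  have "\<forall>e. e \<notin> ladder_arcs k \<longrightarrow> f e = 0"
    using assms by (auto simp: st_flow_def)
  from ladder_sums[OF this] show ?thesis
    by (simp add: flow_value_def numeral_2_eq_2)
qed

text \<open>At most one arc of unit capacity leaves the source: the rung if \<open>k = 1\<close>, a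
  rail arc otherwise.\<close>

lemma ladder_flow_value_le:
  assumes "st_flow (ladder n k) 0 t f"
  shows "flow_value (ladder n k) 0 f \<le> 1"
proof -
  have z: "e \<notin> ladder_arcs k \<Longrightarrow> f e = 0" and le: "f e \<le> 1" for e
    using st_flowD[OF assms] by simp_all
  show ?thesis
  proof (cases "k = 1")
    case True
    then have "f (0, 2) = 0" by (intro z) (simp add: ladder_arcs_def)
    then show ?thesis using ladder_flow_value[OF assms] le[of "(0, 1)"] by simp
  next
    case False
    then have "f (0, 1) = 0" by (intro z) (simp add: ladder_arcs_def)
    then show ?thesis using ladder_flow_value[OF assms] le[of "(0, 2)"] by simp
  qed
qed

definition rung_path :: "nat \<Rightarrow> nat \<Rightarrow> (nat \<times> nat) set" where
  "rung_path k i = {(x, y). y = x + 2 \<and> even x \<and> x < 2 * i} \<union> {(2 * i, 2 * i + 1)} \<union>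
     {(x, y). y = x + 2 \<and> odd x \<and> 2 * i < x \<and> y < 2 * k}"

text \<open>The arcs of \<open>rung_path k i\<close> form one path from source to sink that changes
  rails at rung \<open>i\<close>, so every other vertex is entered and left equally often.\<close>

lemma rung_path_flow:
  assumes "i < k" "0 < i \<or> k = 1" "2 * k \<le> n"
  shows "st_flow (ladder n k) 0 (2 * k - 1) (indicator (rung_path k i))"
    and "flow_value (ladder n k) 0 (indicator (rung_path k i)) = 1"
proof -
  let ?f = "indicator (rung_path k i) :: nat \<times> nat \<Rightarrow> real"
  have z: "\<forall>e. e \<notin> ladder_arcs k \<longrightarrow> ?f e = 0"
    using assms(1,2) by (auto simp: rung_path_def ladder_arcs_def indicator_def)
  note sums = ladder_sums[OF z]
  have "sum ?f (in_arcs (ladder n k) v) = sum ?f (out_arcs (ladder n k) v)"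
    if v: "v \<noteq> 0" "v \<noteq> 2 * k - 1" for v
  proof -
    consider "v = 1" | m where "v = 2 * m + 2" | m where "v = (2 * m + 1) + 2"
    proof -
      have "v = 1 \<or> (\<exists>m. v = 2 * m + 2) \<or> (\<exists>m. v = (2 * m + 1) + 2)"
        using v(1) by presburger
      then show thesis using that by blast
    qed
    then show ?thesis
    proof cases
      case 1
      \<comment> \<open>Rung 0 exists only for \<open>k = 1\<close>, and then vertex 1 is the
        sink.\<close>
      then have "i \<noteq> 0" using v(2) assms(1,2) by auto
      then show ?thesis
        unfolding 1 sums by (simp add: rung_path_def indicator_def)
    next
      case 2
      show ?thesis
        unfolding 2 sums by (auto simp: rung_path_def indicator_def) presburger
    next
      case 3
      then have "m + 2 \<noteq> k" using v(2) by auto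
      then show ?thesis
        unfolding 3 sums using assms(1) by (auto simp: rung_path_def indicator_def; presburger)
    qed
  qed
  then show flow: "st_flow (ladder n k) 0 (2 * k - 1) ?f"
    unfolding st_flow_def using z by (auto simp: indicator_def)
  show "flow_value (ladder n k) 0 ?f = 1"
    unfolding ladder_flow_value[OF flow] using assms(1,2)
    by (auto simp: rung_path_def indicator_def)
qed

text \<open>The two rail arcs at level \<open>l\<close> form a cut, so together they carry the whole
  flow. Rungs only lead away from the even rail, so the flow on that rail never grows.\<close>

lemma ladder_rail_sums:
  assumes flow: "st_flow (ladder n k) 0 (2 * k - 1) f" and "2 * k \<le> n" "l + 1 < k"
  shows "f (2 * l, 2 * l + 2) + f (2 * l + 1, 2 * l + 3) = f (0, 2)"
    and "m \<le> l \<Longrightarrow> f (2 * l, 2 * l + 2) \<le> f (2 * m, 2 * m + 2)"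
proof -
  have z: "e \<notin> ladder_arcs k \<Longrightarrow> f e = 0" and nonneg: "0 \<le> f e" for e
    using st_flowD[OF flow] by simp_all
  then have "\<forall>e. e \<notin> ladder_arcs k \<longrightarrow> f e = 0" by blast
  note sums = ladder_sums[OF this]
  have cons: "sum f (in_arcs (ladder n k) v) = sum f (out_arcs (ladder n k) v)"
    if "0 < v" "v + 1 < 2 * k" for v
    using flow that assms(2) by (auto simp: st_flow_def)
  have even_vertex: "f (2 * l, 2 * l + 2) = f (2 * l + 2, 2 * l + 3) + f (2 * l + 2, 2 * l + 4)"
    if "l + 2 < k" for l
  proof -
    have "f (2 * l + 1, 2 * l + 2) = 0" by (intro z) (simp add: ladder_arcs_def)
    then show ?thesis
      using cons[of "2 * l + 2"] that sums(1)[of n "2 * l + 2"] sums(4)[of n "2 * l"]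
      by (simp add: numeral_eq_Suc)
  qed
  have odd_vertex: "f (2 * l + 1, 2 * l + 3) + f (2 * l + 2, 2 * l + 3) = f (2 * l + 3, 2 * l + 5)"
    if "l + 2 < k" for l
  proof -
    have "f (2 * l + 3, 2 * l + 4) = 0" by (intro z) (simp add: ladder_arcs_def)
    then show ?thesis
      using cons[of "2 * l + 3"] that sums(1)[of n "2 * l + 3"] sums(4)[of n "2 * l + 1"]
      by (simp add: numeral_eq_Suc)
  qed
  show "f (2 * l, 2 * l + 2) + f (2 * l + 1, 2 * l + 3) = f (0, 2)"
    using assms(3)
  proof (induction l)
    \<comment> \<open>Here \<open>k\<close> is at least 2, so there is no rung at 0. Nothing enters
      vertex 1, hence nothing leaves it.\<close>
    case 0
    then have "f (0, 1) = 0" "f (1, 2) = 0" by (auto intro!: z simp: ladder_arcs_def)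
    then have "f (1, 3) = 0"
      using cons[of 1] 0 sums(1)[of n 1] sums(3)[of n] by (simp add: numeral_eq_Suc)
    then show ?case by (simp add: numeral_2_eq_2)
  next
    \<comment> \<open>Adding the two conservation laws cancels the flow on the rung between
      them.\<close>
    case (Suc l)
    then show ?case using even_vertex[of l] odd_vertex[of l] by (simp add: numeral_eq_Suc)
  qed
  show "f (2 * l, 2 * l + 2) \<le> f (2 * m, 2 * m + 2)" if "m \<le> l"
    using that assms(3)
  proof (induction l rule: dec_induct)
    case (step l)
    then show ?case
      using even_vertex[of l] nonneg[of "(2 * l + 2, 2 * l + 3)"] by (simp add: numeral_eq_Suc)
  qed simp
qed

text \<open>For positive \<open>i\<close>, a path that changes rails before rung \<open>i\<close>
  needs the second arc, and one that changes after it needs the first.\<close>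

definition around_rung :: "nat \<Rightarrow> (nat \<times> nat) set" where
  "around_rung i = {(2 * i, 2 * i + 2), (2 * i - 1, 2 * i + 1)}"

text \<open>The even rail is empty after rung \<open>i\<close> and stays empty by monotonicity. Just
  before rung \<open>j\<close> the odd rail is blocked as well, so the cut at level
  \<open>j - 1\<close> carries nothing.\<close>

lemma around_rungs_separate:
  assumes "st_flow (ladder n k) 0 (2 * k - 1) f" "2 * k \<le> n"
    and "i < j" "j + 1 < k" "\<forall>e\<in>around_rung i \<union> around_rung j. f e = 0"
  shows "flow_value (ladder n k) 0 f \<le> 0"
proof -
  obtain l where l: "j = l + 1" "i \<le> l"
    using \<open>i < j\<close> by (metis Suc_eq_plus1 less_Suc_eq_le not0_implies_Suc not_less0)
  have "f (2 * l, 2 * l + 2) \<le> 0" "f (2 * l + 1, 2 * l + 3) = 0"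
    using ladder_rail_sums(2)[OF assms(1,2), of l i] l assms(4,5)
    by (auto simp: around_rung_def numeral_eq_Suc)
  then have "f (0, 2) \<le> 0"
    using ladder_rail_sums(1)[OF assms(1,2), of l] l assms(4) by simp
  moreover have "f (0, 1) = 0"
    using assms(1,4) by (simp add: st_flow_def ladder_arcs_def)
  ultimately show ?thesis using ladder_flow_value[OF assms(1)] by simp
qed

theorem theorem15:
  shows "\<exists>b :: nat \<Rightarrow> nat.
    (\<lambda>n. real (b n)) \<in> \<Omega>(\<lambda>n. real n) \<and>
    (\<forall>n\<ge>2. \<exists>(G :: nat pair_pre_digraph) s t.
       pair_digraph G \<and> card (pverts G) = n \<and>
       s \<in> pverts G \<and> t \<in> pverts G \<and> s \<noteq> t \<and>
       max_flow_value G s t = 1 \<and>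
       (\<forall>\<A>. family_A G s t \<A> \<longrightarrow> infinite \<A> \<or> b n \<le> card \<A>) \<and>
       (\<forall>\<B>. family_B G s t \<B> \<longrightarrow> infinite \<B> \<or> b n \<le> card \<B>))"
proof (intro exI[of _ "\<lambda>n. n div 2 - 2"] conjI allI impI)
  \<comment> \<open>\<open>n div 2 - 2\<close> is at least (n - 5)/2, which is at least n/4 once n
    is at least 10.\<close>
  have "eventually (\<lambda>n. norm (real (n div 2 - 2)) \<ge> 1/4 * norm (real n)) at_top"
    using eventually_ge_at_top[of 12] by eventually_elim (simp; linarith)
  then show "(\<lambda>n. real (n div 2 - 2)) \<in> \<Omega>(\<lambda>n. real n)"
    by (intro landau_omega.bigI[of "1/4"]) auto
next
  fix n :: nat
  assume "2 \<le> n"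
  \<comment> \<open>For odd \<open>n\<close> the last vertex is isolated.\<close>
  define k where "k = n div 2"
  have k: "0 < k" "2 * k \<le> n" using \<open>2 \<le> n\<close> by (auto simp: k_def)
  define G where "G = ladder n k"
  \<comment> \<open>Rung 0 has no odd rail arc before it and rung \<open>k - 1\<close> no even rail
    arc after it. For \<open>n < 6\<close> no index remains and the bound is 0.\<close>
  define I where "I = {1..<k - 1}"
  have fin: "finite (parcs G)" by (simp add: G_def finite_ladder_arcs)
  have le: "flow_value G 0 g \<le> 1" if "st_flow G 0 (2 * k - 1) g" for g
    using that ladder_flow_value_le unfolding G_def by blast
  have arcs: "around_rung i \<subseteq> parcs G \<and> card (around_rung i) = 2" if "i \<in> I" for i
    using that by (auto simp: I_def G_def around_rung_def ladder_arcs_def)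
  have path: "\<exists>f. st_flow G 0 (2 * k - 1) f \<and> flow_value G 0 f = 1 \<and> (\<forall>e\<in>around_rung i. f e = 0)"
    if "i \<in> I" for i
  proof (intro exI conjI)
    have i: "i < k" "0 < i \<or> k = 1" using that by (auto simp: I_def)
    show "st_flow G 0 (2 * k - 1) (indicator (rung_path k i))"
      "flow_value G 0 (indicator (rung_path k i)) = 1"
      unfolding G_def by (rule rung_path_flow[OF i k(2)])+
    show "\<forall>e\<in>around_rung i. indicator (rung_path k i) e = (0::real)"
      using that by (auto simp: I_def around_rung_def rung_path_def indicator_def)
  qed
  have sep: "flow_value G 0 f \<noteq> 1"
    if "i \<in> I" "j \<in> I" "i \<noteq> j" "st_flow G 0 (2 * k - 1) f"
      "\<forall>e\<in>around_rung i \<union> around_rung j. f e = 0" for i j f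
    \<comment> \<open>The cut argument needs the indices in increasing order, hence both
      instances.\<close>
    using around_rungs_separate[of n k f i j] around_rungs_separate[of n k f j i] that k(2)
    by (cases "i < j") (auto simp: I_def G_def Un_commute less_diff_conv)
  have "infinite \<A> \<or> card I \<le> card \<A>" if "family_A G 0 (2 * k - 1) \<A>" for \<A>
    by (rule families_large(1)[OF fin le arcs path sep that])
  moreover have "infinite \<B> \<or> card I \<le> card \<B>" if "family_B G 0 (2 * k - 1) \<B>" for \<B>
    by (rule families_large(2)[OF fin le arcs path sep that])
  moreover have "max_flow_value G 0 (2 * k - 1) = 1"
  proof (rule max_flow_value_eqI[OF le])
    \<comment> \<open>The last rung is present for every positive \<open>k\<close>, so this witness
      also covers the ladders with empty \<open>I\<close>.\<close>
    have "k - 1 < k" "0 < k - 1 \<or> k = 1" using k(1) by auto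
    from rung_path_flow[OF this k(2)]
    show "st_flow G 0 (2 * k - 1) (indicator (rung_path k (k - 1)))"
      "flow_value G 0 (indicator (rung_path k (k - 1))) = 1"
      unfolding G_def .
  qed
  moreover have "card I = n div 2 - 2" by (simp add: I_def k_def)
  ultimately show "\<exists>(G :: nat pair_pre_digraph) s t.
       pair_digraph G \<and> card (pverts G) = n \<and>
       s \<in> pverts G \<and> t \<in> pverts G \<and> s \<noteq> t \<and>
       max_flow_value G s t = 1 \<and>
       (\<forall>\<A>. family_A G s t \<A> \<longrightarrow> infinite \<A> \<or> n div 2 - 2 \<le> card \<A>) \<and>
       (\<forall>\<B>. family_B G s t \<B> \<longrightarrow> infinite \<B> \<or> n div 2 - 2 \<le> card \<B>)"
    using pair_digraph_ladder[OF k(2)] k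
    by (intro exI[of _ G] exI[of _ 0] exI[of _ "2 * k - 1"]) (auto simp: G_def)
qed

end
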